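(* Let $c,\beta,\sigma$ be three real parameters and $\kappa\in(0,1)$. Then the following are families of solutions of $$\varphi'^2=\frac12\left(\beta-\frac1c\right)\varphi^4+\sigma\varphi^2+a,$$ where $a$ is a (real) constant of integration. (i) If $c\neq0$, $\beta<\frac1c$ and $\sigma>0$, then there is a family of dnoidal solutions $\varphi(x)=\varphi_0\,\mathrm{dn}(\alpha x,\kappa)$ with parameters $$\varphi_0^2=\frac{2\sigma}{(2-\kappa^2)(\frac1c-\beta)},\qquad \alpha^2=\frac{\sigma}{2-\kappa^2},$$ and fundamental period $2T=\frac{2K(\kappa)}{\alpha}=\frac{2K(\kappa)\sqrt{2-\kappa^2}}{\sqrt\sigma}$. This is a three free parameter family, depending on and uniquely determined by $(\frac1c-\beta,\sigma,\kappa)\in\mathbb{R}_+\times\mathbb{R}_+\times(0,1)$. (ii) If $c\neq0$, $\beta>\frac1c$ and $\sigma<0$, then there is a family of snoidal solutions $\varphi(x)=\varphi_0\,\mathrm{sn}(\alpha x,\kappa)$ with parameters $$\varphi_0^2=\frac{2\sigma\kappa^2}{(\frac1c-\beta)(1+\kappa^2)},\qquad \alpha^2=-\frac{\sigma}{1+\kappa^2},$$ and fundamental period $2T=4K(\kappa)\frac{\sqrt{1+\kappa^2}}{\sqrt{-\sigma}}$. This family is also uniquely determined by the three independent parameters $(\frac1c-\beta,\sigma,\kappa)\in\mathbb{R}_-\times\mathbb{R}_-\times(0,1)$.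
   Context: $\mathrm{dn}(\cdot,\kappa)$, $\mathrm{sn}(\cdot,\kappa)$ are the Jacobi elliptic functions of modulus $\kappa$, and $K(\kappa)$ is the complete elliptic integral of the first kind. The constants $\varphi_0,\alpha$ are taken positive. $\mathbb{R}_+$ and $\mathbb{R}_-$ denote the positive and negative reals. The constant of integration $a$ is allowed to depend on the solution. The displayed ODE is the once-integrated form of the profile equation $\varphi''-\sigma\varphi=(\beta-\frac1c)\varphi^3$ for periodic traveling waves of the Benney system $iu_t+u_{xx}=uv+\beta|u|^2u$, $v_t=(|u|^2)_x$. *)

theory Defs
  imports "HOL-Analysis.Analysis"
begin

text \<open>
  Real Jacobi elliptic functions, parametrised by the modulus \<open>\<kappa>\<close> (not by \<open>m = \<kappa>\<^sup>2\<close>), for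
  \<open>0 < \<kappa> < 1\<close>. The interval integral is oriented, so \<open>ellipticF \<theta> \<kappa>\<close> is negative for
  \<open>\<theta> < 0\<close>; as a function of \<open>\<theta>\<close> it is an increasing bijection of the reals, whose inverse is
  the amplitude.
\<close>

definition ellipticF :: "real \<Rightarrow> real \<Rightarrow> real" where
  "ellipticF \<theta> \<kappa> = (LBINT t=ereal 0..ereal \<theta>. 1 / sqrt (1 - \<kappa>\<^sup>2 * (sin t)\<^sup>2))"

definition ellipticK :: "real \<Rightarrow> real" where
  "ellipticK \<kappa> = ellipticF (pi / 2) \<kappa>"

definition jacobi_am :: "real \<Rightarrow> real \<Rightarrow> real" where
  "jacobi_am u \<kappa> = (THE \<theta>. ellipticF \<theta> \<kappa> = u)"

definition jacobi_sn :: "real \<Rightarrow> real \<Rightarrow> real" where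
  "jacobi_sn u \<kappa> = sin (jacobi_am u \<kappa>)"

definition jacobi_dn :: "real \<Rightarrow> real \<Rightarrow> real" where
  "jacobi_dn u \<kappa> = sqrt (1 - \<kappa>\<^sup>2 * (jacobi_sn u \<kappa>)\<^sup>2)"

definition solves_profile_ode :: "real \<Rightarrow> real \<Rightarrow> real \<Rightarrow> (real \<Rightarrow> real) \<Rightarrow> bool" where
  "solves_profile_ode c \<beta> \<sigma> \<phi> \<longleftrightarrow>
     (\<exists>a::real. \<forall>x. \<phi> field_differentiable (at x) \<and>
        (deriv \<phi> x)\<^sup>2 = 1/2 * (\<beta> - 1/c) * (\<phi> x)^4 + \<sigma> * (\<phi> x)\<^sup>2 + a)"

definition fundamental_period :: "(real \<Rightarrow> real) \<Rightarrow> real \<Rightarrow> bool" where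
  "fundamental_period f P \<longleftrightarrow>
     0 < P \<and> (\<forall>x. f (x + P) = f x) \<and>
     (\<forall>Q. 0 < Q \<and> Q < P \<longrightarrow> \<not> (\<forall>x. f (x + Q) = f x))"

text \<open>
  The amplitude and the wave number are arbitrary positive numbers in the next two definitions;
  that they are forced to have particular values is a claim about these sets.
\<close>

definition dnoidal_solutions :: "real \<Rightarrow> real \<Rightarrow> real \<Rightarrow> real \<Rightarrow> (real \<Rightarrow> real) set" where
  "dnoidal_solutions c \<beta> \<sigma> \<kappa> =
     {\<phi>. solves_profile_ode c \<beta> \<sigma> \<phi> \<and>
         (\<exists>\<phi>\<^sub>0>0. \<exists>\<alpha>>0. \<phi> = (\<lambda>x. \<phi>\<^sub>0 * jacobi_dn (\<alpha> * x) \<kappa>))}"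

definition snoidal_solutions :: "real \<Rightarrow> real \<Rightarrow> real \<Rightarrow> real \<Rightarrow> (real \<Rightarrow> real) set" where
  "snoidal_solutions c \<beta> \<sigma> \<kappa> =
     {\<phi>. solves_profile_ode c \<beta> \<sigma> \<phi> \<and>
         (\<exists>\<phi>\<^sub>0>0. \<exists>\<alpha>>0. \<phi> = (\<lambda>x. \<phi>\<^sub>0 * jacobi_sn (\<alpha> * x) \<kappa>))}"

end

theory Submission
  imports Defs
begin

text \<open>
  Both \<open>dn\<close> and \<open>sn\<close> satisfy a first-order equation of exactly the shape of the profile equation,
  \<open>w'\<^sup>2 = p w\<^sup>4 + q w\<^sup>2 + r\<close>, with \<open>(p, q, r) = (-1, 2 - \<kappa>\<^sup>2, -(1 - \<kappa>\<^sup>2))\<close> and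
  \<open>(p, q, r) = (\<kappa>\<^sup>2, -(1 + \<kappa>\<^sup>2), 1)\<close> respectively. This follows from the chain rule once the
  amplitude is known to be differentiable with \<open>am' = dn\<close>, which is the inverse function rule
  applied to the incomplete elliptic integral.

  Rescaling gives \<open>\<phi>(x) = A w(\<alpha> x)\<close> the coefficients \<open>(\<alpha>\<^sup>2 p / A\<^sup>2, \<alpha>\<^sup>2 q, \<alpha>\<^sup>2 A\<^sup>2 r)\<close>. The square of
  each profile takes at least three values, and a quadratic polynomial is determined by three
  values, so a profile determines the coefficients of any such equation that it satisfies
  (\<open>quartic_profile_unique\<close>). This fact is used twice. First, \<open>\<phi>\<close> solves the given equation
  only if \<open>\<alpha>\<^sup>2 q = \<sigma>\<close> and \<open>\<alpha>\<^sup>2 p / A\<^sup>2 = (\<beta> - 1/c)/2\<close>, which fixes \<open>A\<close> and \<open>\<alpha>\<close>. Secondly, \<open>\<phi>\<close> as a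
  bare function determines \<open>1/c - \<beta>\<close>, \<open>\<sigma>\<close> and the constant of integration, hence also the
  scale-invariant number \<open>p r / q\<^sup>2\<close>. This number is \<open>t / (1 + t)\<^sup>2\<close> with \<open>t = 1 - \<kappa>\<^sup>2\<close> or \<open>t = \<kappa>\<^sup>2\<close>, an
  injective function of \<open>t \<in> (0, 1)\<close>, so \<open>\<kappa>\<close> is determined too.

  For the periods, the integrand of the elliptic integral is even and \<open>\<pi>\<close>-periodic, which gives
  \<open>am (u + 2K) = am u + \<pi>\<close>. No smaller period exists because \<open>dn\<close> attains its maximum \<open>1\<close> only where
  the amplitude is a multiple of \<open>\<pi>\<close>, and \<open>sn\<close> attains its maximum \<open>1\<close> only where the amplitude is
  \<open>\<pi>/2\<close> modulo \<open>2\<pi>\<close>.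
\<close>

section \<open>The amplitude\<close>

lemma one_minus_modulus_sin_sq_pos:
  fixes \<kappa> t :: real
  assumes "0 < \<kappa>" "\<kappa> < 1"
  shows "0 < 1 - \<kappa>\<^sup>2 * (sin t)\<^sup>2"
proof -
  have "\<kappa>\<^sup>2 < 1" using assms by (simp add: power_less_one_iff)
  moreover have "\<kappa>\<^sup>2 * (sin t)\<^sup>2 \<le> \<kappa>\<^sup>2 * 1"
    by (intro mult_left_mono) (auto simp: abs_square_le_1)
  ultimately show ?thesis by linarith
qed

lemma ellipticF_0 [simp]: "ellipticF 0 \<kappa> = 0"
  by (simp add: ellipticF_def zero_ereal_def[symmetric])

lemma ellipticF_has_derivative:
  assumes "0 < \<kappa>" "\<kappa> < 1"
  shows "((\<lambda>\<theta>. ellipticF \<theta> \<kappa>) has_real_derivative 1 / sqrt (1 - \<kappa>\<^sup>2 * (sin \<theta>)\<^sup>2)) (at \<theta>)"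
proof -
  let ?f = "\<lambda>t. 1 / sqrt (1 - \<kappa>\<^sup>2 * (sin t)\<^sup>2)"
  \<comment> \<open>The interval has both \<open>0\<close> and \<open>\<theta>\<close> in its interior, so the derivative at \<open>\<theta>\<close> is two-sided.\<close>
  define a where "a = min 0 \<theta> - 1"
  define b where "b = max 0 \<theta> + 1"
  have "continuous_on {a..b} ?f"
    using one_minus_modulus_sin_sq_pos[OF assms]
    by (intro continuous_intros) (auto simp: less_imp_neq[symmetric])
  then have "((\<lambda>u. LBINT t=ereal 0..ereal u. ?f t) has_vector_derivative ?f \<theta>) (at \<theta> within {a..b})"
    by (intro interval_integral_FTC2) (auto simp: a_def b_def)
  moreover have "at \<theta> within {a..b} = at \<theta>"
    by (rule at_within_Icc_at) (auto simp: a_def b_def)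
  ultimately show ?thesis
    by (simp add: ellipticF_def[abs_def] has_real_derivative_iff_has_vector_derivative)
qed

lemma ellipticF_strict_mono:
  assumes "0 < \<kappa>" "\<kappa> < 1"
  shows "strict_mono (\<lambda>\<theta>. ellipticF \<theta> \<kappa>)"
proof (rule strict_monoI)
  fix x y :: real
  assume "x < y"
  then show "ellipticF x \<kappa> < ellipticF y \<kappa>"
  proof (rule DERIV_pos_imp_increasing)
    fix t :: real
    have "0 < 1 / sqrt (1 - \<kappa>\<^sup>2 * (sin t)\<^sup>2)"
      using one_minus_modulus_sin_sq_pos[OF assms, of t] by simp
    then show "\<exists>y. ((\<lambda>\<theta>. ellipticF \<theta> \<kappa>) has_real_derivative y) (at t) \<and> 0 < y"
      using ellipticF_has_derivative[OF assms, of t] by blast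
  qed
qed

text \<open>
  The integrand is at least \<open>1\<close>, so \<open>F(\<theta>) - \<theta>\<close> is nondecreasing. Hence \<open>F\<close> lies above the identity on
  the right of \<open>0\<close> and below it on the left, and the intermediate value theorem applies.
\<close>

lemma ellipticF_surj:
  assumes "0 < \<kappa>" "\<kappa> < 1"
  obtains \<theta> where "ellipticF \<theta> \<kappa> = u"
proof -
  let ?F = "\<lambda>\<theta>. ellipticF \<theta> \<kappa>"
  have mono: "?F x - x \<le> ?F y - y" if "x \<le> y" for x y
  proof (rule DERIV_nonneg_imp_nondecreasing[OF that])
    fix t :: real
    let ?D = "1 / sqrt (1 - \<kappa>\<^sup>2 * (sin t)\<^sup>2)"
    have "((\<lambda>\<theta>. ?F \<theta> - \<theta>) has_real_derivative ?D - 1) (at t)"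
      by (intro derivative_intros ellipticF_has_derivative assms)
    moreover have "sqrt (1 - \<kappa>\<^sup>2 * (sin t)\<^sup>2) \<le> 1" by simp
    then have "0 \<le> ?D - 1"
      using one_minus_modulus_sin_sq_pos[OF assms, of t] by simp
    ultimately show "\<exists>y. ((\<lambda>\<theta>. ?F \<theta> - \<theta>) has_real_derivative y) (at t) \<and> 0 \<le> y"
      by blast
  qed
  have cont: "isCont ?F x" for x
    using ellipticF_has_derivative[OF assms] by (rule DERIV_isCont)
  have "\<exists>\<theta>. - \<bar>u\<bar> \<le> \<theta> \<and> \<theta> \<le> \<bar>u\<bar> \<and> ?F \<theta> = u"
    using mono[of 0 "\<bar>u\<bar>"] mono[of "- \<bar>u\<bar>" 0] cont by (intro IVT) auto
  then show ?thesis using that by blast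
qed

lemma jacobi_am_ellipticF:
  assumes "0 < \<kappa>" "\<kappa> < 1"
  shows "jacobi_am (ellipticF \<theta> \<kappa>) \<kappa> = \<theta>"
  unfolding jacobi_am_def
  using strict_mono_eq[OF ellipticF_strict_mono[OF assms]] by (intro the_equality) auto

lemma ellipticF_jacobi_am:
  assumes "0 < \<kappa>" "\<kappa> < 1"
  shows "ellipticF (jacobi_am u \<kappa>) \<kappa> = u"
  by (metis assms ellipticF_surj jacobi_am_ellipticF)

lemma jacobi_am_strict_mono:
  assumes "0 < \<kappa>" "\<kappa> < 1"
  shows "strict_mono (\<lambda>u. jacobi_am u \<kappa>)"
  by (rule strict_monoI)
    (metis assms ellipticF_jacobi_am strict_mono_less[OF ellipticF_strict_mono])

lemma jacobi_am_0 [simp]: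
  assumes "0 < \<kappa>" "\<kappa> < 1"
  shows "jacobi_am 0 \<kappa> = 0"
  using jacobi_am_ellipticF[OF assms, of 0] by simp

lemma jacobi_am_ellipticK:
  assumes "0 < \<kappa>" "\<kappa> < 1"
  shows "jacobi_am (ellipticK \<kappa>) \<kappa> = pi / 2"
  unfolding ellipticK_def by (rule jacobi_am_ellipticF[OF assms])

lemma ellipticK_pos:
  assumes "0 < \<kappa>" "\<kappa> < 1"
  shows "0 < ellipticK \<kappa>"
  using strict_monoD[OF ellipticF_strict_mono[OF assms], of 0 "pi / 2"] by (simp add: ellipticK_def)

lemma jacobi_am_has_derivative:
  assumes "0 < \<kappa>" "\<kappa> < 1"
  shows "((\<lambda>u. jacobi_am u \<kappa>) has_real_derivative jacobi_dn u \<kappa>) (at u)"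
proof -
  let ?F = "\<lambda>\<theta>. ellipticF \<theta> \<kappa>"
  let ?am = "\<lambda>u. jacobi_am u \<kappa>"
  have cont: "isCont ?F x" for x
    using ellipticF_has_derivative[OF assms] by (rule DERIV_isCont)
  have "isCont ?am (?F (?am u))"
    by (rule isCont_inverse_function[where d = 1])
      (auto simp: jacobi_am_ellipticF[OF assms] cont)
  then have "isCont ?am u" by (simp add: ellipticF_jacobi_am[OF assms])
  then have "(?am has_real_derivative
      inverse (1 / sqrt (1 - \<kappa>\<^sup>2 * (sin (?am u))\<^sup>2))) (at u)"
    using one_minus_modulus_sin_sq_pos[OF assms, of "?am u"]
    by (intro DERIV_inverse_function[where f = ?F and a = "u - 1" and b = "u + 1"]
        ellipticF_has_derivative[OF assms] ellipticF_jacobi_am[OF assms]) auto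
  then show ?thesis by (simp add: jacobi_dn_def jacobi_sn_def)
qed

section \<open>Periods\<close>

lemma ellipticF_minus:
  assumes "0 < \<kappa>" "\<kappa> < 1"
  shows "ellipticF (- \<theta>) \<kappa> = - ellipticF \<theta> \<kappa>"
proof -
  let ?g = "\<lambda>\<theta>. ellipticF \<theta> \<kappa> + ellipticF (- \<theta>) \<kappa>"
  have "(?g has_real_derivative 0) (at t)" for t
  proof -
    have "((\<lambda>\<theta>. ellipticF (- \<theta>) \<kappa>) has_real_derivative
        1 / sqrt (1 - \<kappa>\<^sup>2 * (sin (- t))\<^sup>2) * (- 1)) (at t)"
      by (rule DERIV_chain2[OF ellipticF_has_derivative[OF assms]])
        (auto intro!: derivative_eq_intros)
    from DERIV_add[OF ellipticF_has_derivative[OF assms] this] show ?thesis by simp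
  qed
  then have "?g \<theta> = ?g 0" by (intro DERIV_isconst_all) auto
  then show ?thesis by simp
qed

lemma ellipticF_add_pi:
  assumes "0 < \<kappa>" "\<kappa> < 1"
  shows "ellipticF (\<theta> + pi) \<kappa> = ellipticF \<theta> \<kappa> + 2 * ellipticK \<kappa>"
proof -
  let ?g = "\<lambda>\<theta>. ellipticF (\<theta> + pi) \<kappa> - ellipticF \<theta> \<kappa>"
  have "(?g has_real_derivative 0) (at t)" for t
  proof -
    have "((\<lambda>\<theta>. ellipticF (\<theta> + pi) \<kappa>) has_real_derivative
        1 / sqrt (1 - \<kappa>\<^sup>2 * (sin (t + pi))\<^sup>2) * 1) (at t)"
      by (rule DERIV_chain2[OF ellipticF_has_derivative[OF assms]])
        (auto intro!: derivative_eq_intros)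
    from DERIV_diff[OF this ellipticF_has_derivative[OF assms]] show ?thesis by simp
  qed
  \<comment> \<open>The increment over a period is evaluated on the symmetric interval from \<open>-\<pi>/2\<close> to \<open>\<pi>/2\<close>.\<close>
  then have "?g \<theta> = ?g (- (pi / 2))" by (intro DERIV_isconst_all) auto
  then show ?thesis by (simp add: ellipticF_minus[OF assms] ellipticK_def)
qed

lemma jacobi_am_add_2K:
  assumes "0 < \<kappa>" "\<kappa> < 1"
  shows "jacobi_am (u + 2 * ellipticK \<kappa>) \<kappa> = jacobi_am u \<kappa> + pi"
  by (metis assms ellipticF_add_pi ellipticF_jacobi_am jacobi_am_ellipticF)

lemma jacobi_sn_add_2K:
  assumes "0 < \<kappa>" "\<kappa> < 1"
  shows "jacobi_sn (u + 2 * ellipticK \<kappa>) \<kappa> = - jacobi_sn u \<kappa>"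
  by (simp add: jacobi_sn_def jacobi_am_add_2K[OF assms])

lemma fundamental_period_jacobi_dn:
  assumes "0 < \<kappa>" "\<kappa> < 1"
  shows "fundamental_period (\<lambda>u. jacobi_dn u \<kappa>) (2 * ellipticK \<kappa>)"
  unfolding fundamental_period_def
proof (intro conjI allI impI notI)
  show "0 < 2 * ellipticK \<kappa>" using ellipticK_pos[OF assms] by simp
  show "jacobi_dn (x + 2 * ellipticK \<kappa>) \<kappa> = jacobi_dn x \<kappa>" for x
    by (simp add: jacobi_dn_def jacobi_sn_add_2K[OF assms])
  fix Q
  assume Q: "0 < Q \<and> Q < 2 * ellipticK \<kappa>"
    and per: "\<forall>x. jacobi_dn (x + Q) \<kappa> = jacobi_dn x \<kappa>"
  have "0 < jacobi_am Q \<kappa>"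
    using strict_monoD[OF jacobi_am_strict_mono[OF assms], of 0 Q] Q assms by simp
  moreover have "jacobi_am Q \<kappa> < pi"
    using strict_monoD[OF jacobi_am_strict_mono[OF assms], of Q "2 * ellipticK \<kappa>"] Q
      jacobi_am_add_2K[OF assms, of 0] assms by simp
  ultimately have "0 < jacobi_sn Q \<kappa>"
    unfolding jacobi_sn_def by (rule sin_gt_zero)
  moreover have "jacobi_dn Q \<kappa> = 1"
    using per[rule_format, of 0] assms by (simp add: jacobi_dn_def jacobi_sn_def)
  ultimately show False using assms by (simp add: jacobi_dn_def)
qed

lemma fundamental_period_jacobi_sn:
  assumes "0 < \<kappa>" "\<kappa> < 1"
  shows "fundamental_period (\<lambda>u. jacobi_sn u \<kappa>) (4 * ellipticK \<kappa>)"
  unfolding fundamental_period_def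
proof (intro conjI allI impI notI)
  let ?K = "ellipticK \<kappa>"
  have shift: "u + 4 * ?K = (u + 2 * ?K) + 2 * ?K" for u by simp
  show "0 < 4 * ?K" using ellipticK_pos[OF assms] by simp
  show "jacobi_sn (x + 4 * ?K) \<kappa> = jacobi_sn x \<kappa>" for x
    unfolding shift jacobi_sn_add_2K[OF assms] by simp
  fix Q
  assume Q: "0 < Q \<and> Q < 4 * ?K"
    and per: "\<forall>x. jacobi_sn (x + Q) \<kappa> = jacobi_sn x \<kappa>"
  \<comment> \<open>At \<open>K\<close> the function \<open>sn\<close> has its maximum, so \<open>K + Q\<close> would be another maximum point.\<close>
  let ?\<theta> = "jacobi_am (?K + Q) \<kappa> - pi / 2"
  have "0 < ?\<theta>"
    using strict_monoD[OF jacobi_am_strict_mono[OF assms], of ?K "?K + Q"] Q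
    by (simp add: jacobi_am_ellipticK[OF assms])
  moreover have "jacobi_am (?K + 4 * ?K) \<kappa> = pi / 2 + 2 * pi"
    unfolding shift jacobi_am_add_2K[OF assms] jacobi_am_ellipticK[OF assms] by simp
  then have "?\<theta> < 2 * pi"
    using strict_monoD[OF jacobi_am_strict_mono[OF assms], of "?K + Q" "?K + 4 * ?K"] Q
    by simp
  moreover have "cos ?\<theta> = 1"
    using per[rule_format, of ?K]
    by (simp add: jacobi_sn_def jacobi_am_ellipticK[OF assms] cos_diff)
  then obtain n :: int where n: "?\<theta> = of_int n * 2 * pi"
    using cos_one_2pi_int by blast
  ultimately have "0 < of_int n * (2 * pi)" "of_int n * (2 * pi) < 1 * (2 * pi)"
    unfolding n by simp_all
  then have "0 < n" "n < 1"
    by (simp_all add: zero_less_mult_iff mult_less_cancel_right)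
  then show False by simp
qed

lemma fundamental_period_rescale:
  assumes "fundamental_period f P" "A \<noteq> 0" "0 < \<alpha>"
  shows "fundamental_period (\<lambda>x. A * f (\<alpha> * x)) (P / \<alpha>)"
  unfolding fundamental_period_def
proof (intro conjI allI impI notI)
  have P: "0 < P" "\<And>x. f (x + P) = f x"
    and min: "\<And>Q. 0 < Q \<Longrightarrow> Q < P \<Longrightarrow> \<not> (\<forall>x. f (x + Q) = f x)"
    using assms(1) by (auto simp: fundamental_period_def)
  show "0 < P / \<alpha>" using P assms by simp
  show "A * f (\<alpha> * (x + P / \<alpha>)) = A * f (\<alpha> * x)" for x
    using P(2)[of "\<alpha> * x"] assms by (simp add: distrib_left)
  fix Q
  assume Q: "0 < Q \<and> Q < P / \<alpha>" and per: "\<forall>x. A * f (\<alpha> * (x + Q)) = A * f (\<alpha> * x)"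
  have "f (y + \<alpha> * Q) = f y" for y
    using per[rule_format, of "y / \<alpha>"] assms by (simp add: distrib_left)
  then show False
    using min[of "\<alpha> * Q"] Q assms by (simp add: field_simps)
qed

section \<open>Equations with an even quartic right-hand side\<close>

definition quartic_profile :: "real \<Rightarrow> real \<Rightarrow> real \<Rightarrow> (real \<Rightarrow> real) \<Rightarrow> bool" where
  "quartic_profile p q r w \<longleftrightarrow>
     (\<forall>x. w field_differentiable (at x) \<and> (deriv w x)\<^sup>2 = p * (w x)^4 + q * (w x)\<^sup>2 + r)"

lemma solves_profile_ode_iff_quartic_profile:
  "solves_profile_ode c \<beta> \<sigma> \<phi> \<longleftrightarrow> (\<exists>a. quartic_profile (1/2 * (\<beta> - 1/c)) \<sigma> a \<phi>)"
  by (simp add: solves_profile_ode_def quartic_profile_def)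

lemma quartic_profileI:
  assumes "\<And>x. (w has_real_derivative w' x) (at x)"
    and "\<And>x. (w' x)\<^sup>2 = p * (w x)^4 + q * (w x)\<^sup>2 + r"
  shows "quartic_profile p q r w"
  using assms unfolding quartic_profile_def field_differentiable_def
  by (metis DERIV_imp_deriv)

lemma quartic_profile_jacobi_sn:
  assumes "0 < \<kappa>" "\<kappa> < 1"
  shows "quartic_profile (\<kappa>\<^sup>2) (- (1 + \<kappa>\<^sup>2)) 1 (\<lambda>u. jacobi_sn u \<kappa>)"
proof (rule quartic_profileI)
  fix u
  let ?am = "jacobi_am u \<kappa>"
  show "((\<lambda>u. jacobi_sn u \<kappa>) has_real_derivative cos ?am * jacobi_dn u \<kappa>) (at u)"
    unfolding jacobi_sn_def
    by (rule DERIV_chain2[OF DERIV_sin jacobi_am_has_derivative[OF assms]])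
  have "(jacobi_dn u \<kappa>)\<^sup>2 = 1 - \<kappa>\<^sup>2 * (sin ?am)\<^sup>2"
    using one_minus_modulus_sin_sq_pos[OF assms, of ?am] by (simp add: jacobi_dn_def jacobi_sn_def)
  then show "(cos ?am * jacobi_dn u \<kappa>)\<^sup>2
      = \<kappa>\<^sup>2 * (jacobi_sn u \<kappa>)^4 + - (1 + \<kappa>\<^sup>2) * (jacobi_sn u \<kappa>)\<^sup>2 + 1"
    by (simp add: power_mult_distrib cos_squared_eq jacobi_sn_def)
      (simp add: algebra_simps power4_eq_xxxx power2_eq_square)
qed

lemma quartic_profile_jacobi_dn:
  assumes "0 < \<kappa>" "\<kappa> < 1"
  shows "quartic_profile (- 1) (2 - \<kappa>\<^sup>2) (- (1 - \<kappa>\<^sup>2)) (\<lambda>u. jacobi_dn u \<kappa>)"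
proof (rule quartic_profileI)
  fix u
  let ?am = "jacobi_am u \<kappa>"
  let ?D = "1 - \<kappa>\<^sup>2 * (sin ?am)\<^sup>2"
  have pos: "0 < ?D" by (rule one_minus_modulus_sin_sq_pos[OF assms])
  have "((\<lambda>u. jacobi_dn u \<kappa>) has_real_derivative
      (- (\<kappa>\<^sup>2 * (2 * sin ?am * (cos ?am * jacobi_dn u \<kappa>)))) * (inverse (sqrt ?D) / 2)) (at u)"
    unfolding jacobi_dn_def[of _ \<kappa>, abs_def] jacobi_sn_def
    using pos
    by (auto intro!: derivative_eq_intros
        jacobi_am_has_derivative[OF assms, unfolded jacobi_dn_def jacobi_sn_def])
  then show "((\<lambda>u. jacobi_dn u \<kappa>) has_real_derivative - (\<kappa>\<^sup>2 * sin ?am * cos ?am)) (at u)"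
    using pos by (simp add: jacobi_dn_def jacobi_sn_def mult.assoc)
  have "(jacobi_dn u \<kappa>)\<^sup>2 = ?D"
    using pos by (simp add: jacobi_dn_def jacobi_sn_def)
  moreover have "(jacobi_dn u \<kappa>)^4 = ((jacobi_dn u \<kappa>)\<^sup>2)\<^sup>2" by simp
  ultimately show "(- (\<kappa>\<^sup>2 * sin ?am * cos ?am))\<^sup>2
      = - 1 * (jacobi_dn u \<kappa>)^4 + (2 - \<kappa>\<^sup>2) * (jacobi_dn u \<kappa>)\<^sup>2 + - (1 - \<kappa>\<^sup>2)"
    by (simp add: power_mult_distrib cos_squared_eq)
      (simp add: algebra_simps power4_eq_xxxx power2_eq_square)
qed

lemma quartic_profile_rescale:
  assumes "quartic_profile p q r w" "A \<noteq> 0"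
  shows "quartic_profile (\<alpha>\<^sup>2 * p / A\<^sup>2) (\<alpha>\<^sup>2 * q) (\<alpha>\<^sup>2 * A\<^sup>2 * r) (\<lambda>x. A * w (\<alpha> * x))"
proof (rule quartic_profileI)
  fix x
  have "(w has_real_derivative deriv w (\<alpha> * x)) (at (\<alpha> * x))"
    using assms(1) by (simp add: quartic_profile_def field_differentiable_derivI)
  then have "((\<lambda>x. w (\<alpha> * x)) has_real_derivative deriv w (\<alpha> * x) * \<alpha>) (at x)"
    by (rule DERIV_chain2) (auto intro!: derivative_eq_intros)
  then show "((\<lambda>x. A * w (\<alpha> * x)) has_real_derivative A * (deriv w (\<alpha> * x) * \<alpha>)) (at x)"
    by (rule DERIV_cmult)
  have "(deriv w (\<alpha> * x))\<^sup>2 = p * (w (\<alpha> * x))^4 + q * (w (\<alpha> * x))\<^sup>2 + r"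
    using assms(1) by (simp add: quartic_profile_def)
  then show "(A * (deriv w (\<alpha> * x) * \<alpha>))\<^sup>2 = \<alpha>\<^sup>2 * p / A\<^sup>2 * (A * w (\<alpha> * x))^4
      + \<alpha>\<^sup>2 * q * (A * w (\<alpha> * x))\<^sup>2 + \<alpha>\<^sup>2 * A\<^sup>2 * r"
    using assms(2) by (simp add: power_mult_distrib) (simp add: field_simps power4_eq_xxxx power2_eq_square)
qed

text \<open>
  Three distinct values of \<open>w\<^sup>2\<close> are three distinct roots of the difference of the two right-hand
  sides, a polynomial of degree at most two in \<open>w\<^sup>2\<close>.
\<close>

lemma quartic_profile_unique:
  assumes "quartic_profile p q r w" "quartic_profile p' q' r' w"
    and "(w x)\<^sup>2 \<noteq> (w y)\<^sup>2" "(w y)\<^sup>2 \<noteq> (w z)\<^sup>2" "(w x)\<^sup>2 \<noteq> (w z)\<^sup>2"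
  shows "p = p'" "q = q'" "r = r'"
proof -
  define P where "P = p - p'"
  define Q where "Q = q - q'"
  define R where "R = r - r'"
  have root: "P * ((w t)\<^sup>2)\<^sup>2 + Q * (w t)\<^sup>2 + R = 0" for t
  proof -
    have "p * (w t)^4 + q * (w t)\<^sup>2 + r = p' * (w t)^4 + q' * (w t)\<^sup>2 + r'"
      using assms(1,2) unfolding quartic_profile_def by metis
    then show ?thesis by (simp add: P_def Q_def R_def algebra_simps)
  qed
  have slope: "P * ((w s)\<^sup>2 + (w t)\<^sup>2) + Q = 0" if "(w s)\<^sup>2 \<noteq> (w t)\<^sup>2" for s t
  proof -
    have "((w s)\<^sup>2 - (w t)\<^sup>2) * (P * ((w s)\<^sup>2 + (w t)\<^sup>2) + Q) = 0"
      using root[of s] root[of t] by algebra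
    then show ?thesis using that by simp
  qed
  have "P * ((w x)\<^sup>2 - (w z)\<^sup>2) = 0"
    using slope[OF assms(3)] slope[OF assms(4)] by algebra
  then have "P = 0" using assms(5) by simp
  moreover from this have "Q = 0" using slope[OF assms(3)] by simp
  moreover from calculation have "R = 0" using root[of x] by simp
  ultimately show "p = p'" "q = q'" "r = r'" by (auto simp: P_def Q_def R_def)
qed

section \<open>Families of rescaled profiles\<close>

text \<open>
  The dnoidal and the snoidal family differ only in the coefficients of the equation of the profile.
  The invariant \<open>p r / q\<^sup>2\<close> does not change under rescaling, and its injectivity is what makes the
  modulus recoverable from a rescaled profile.
\<close>

locale profile_family =
  fixes w :: "real \<Rightarrow> real \<Rightarrow> real" and p q r :: "real \<Rightarrow> real"
  assumes profile: "\<And>\<kappa>. \<kappa> \<in> {0<..<1} \<Longrightarrow> quartic_profile (p \<kappa>) (q \<kappa>) (r \<kappa>) (\<lambda>u. w u \<kappa>)"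
    and three_values: "\<And>\<kappa>. \<kappa> \<in> {0<..<1} \<Longrightarrow>
      \<exists>x y z. (w x \<kappa>)\<^sup>2 \<noteq> (w y \<kappa>)\<^sup>2 \<and> (w y \<kappa>)\<^sup>2 \<noteq> (w z \<kappa>)\<^sup>2 \<and> (w x \<kappa>)\<^sup>2 \<noteq> (w z \<kappa>)\<^sup>2"
    and inj_invariant: "inj_on (\<lambda>\<kappa>. p \<kappa> * r \<kappa> / (q \<kappa>)\<^sup>2) {0<..<1}"
begin

definition amplitude :: "real \<Rightarrow> real \<Rightarrow> real \<Rightarrow> real" where
  "amplitude b \<sigma> \<kappa> = sqrt (- (2 * \<sigma> * p \<kappa> / (q \<kappa> * b)))"

definition wavenumber :: "real \<Rightarrow> real \<Rightarrow> real" where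
  "wavenumber \<sigma> \<kappa> = sqrt (\<sigma> / q \<kappa>)"

text \<open>The argument \<open>b\<close> stands for \<open>1/c - \<beta>\<close>, so the quartic coefficient of the equation is \<open>-b/2\<close>.\<close>

definition wave :: "real \<times> real \<times> real \<Rightarrow> real \<Rightarrow> real" where
  "wave = (\<lambda>(b, \<sigma>, \<kappa>) x. amplitude b \<sigma> \<kappa> * w (wavenumber \<sigma> \<kappa> * x) \<kappa>)"

definition solutions :: "real \<Rightarrow> real \<Rightarrow> real \<Rightarrow> real \<Rightarrow> (real \<Rightarrow> real) set" where
  "solutions c \<beta> \<sigma> \<kappa> = {\<phi>. solves_profile_ode c \<beta> \<sigma> \<phi> \<and>
     (\<exists>A>0. \<exists>\<alpha>>0. \<phi> = (\<lambda>x. A * w (\<alpha> * x) \<kappa>))}"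

lemma rescaled_coefficients_unique:
  assumes "\<kappa> \<in> {0<..<1}" "A \<noteq> 0" "\<alpha> \<noteq> 0"
    and "quartic_profile P Q R (\<lambda>x. A * w (\<alpha> * x) \<kappa>)"
  shows "P = \<alpha>\<^sup>2 * p \<kappa> / A\<^sup>2" "Q = \<alpha>\<^sup>2 * q \<kappa>" "R = \<alpha>\<^sup>2 * A\<^sup>2 * r \<kappa>"
proof -
  obtain x y z where xyz: "(w x \<kappa>)\<^sup>2 \<noteq> (w y \<kappa>)\<^sup>2" "(w y \<kappa>)\<^sup>2 \<noteq> (w z \<kappa>)\<^sup>2" "(w x \<kappa>)\<^sup>2 \<noteq> (w z \<kappa>)\<^sup>2"
    using three_values[OF assms(1)] by blast
  note * = quartic_profile_unique[OF assms(4) quartic_profile_rescale[OF profile[OF assms(1)] assms(2)],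
      of "x / \<alpha>" "y / \<alpha>" "z / \<alpha>"]
  show "P = \<alpha>\<^sup>2 * p \<kappa> / A\<^sup>2" "Q = \<alpha>\<^sup>2 * q \<kappa>" "R = \<alpha>\<^sup>2 * A\<^sup>2 * r \<kappa>"
    using * xyz assms(2,3) by (simp_all add: power_mult_distrib)
qed

context
  fixes b \<sigma> \<kappa> :: real
  assumes modulus: "\<kappa> \<in> {0<..<1}" and sign_b: "p \<kappa> * b < 0" and sign_\<sigma>: "0 < q \<kappa> * \<sigma>"
begin

lemma wavenumber_sq: "(wavenumber \<sigma> \<kappa>)\<^sup>2 = \<sigma> / q \<kappa>" and wavenumber_pos: "0 < wavenumber \<sigma> \<kappa>"
  and amplitude_sq: "(amplitude b \<sigma> \<kappa>)\<^sup>2 = - (2 * \<sigma> * p \<kappa> / (q \<kappa> * b))"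
  and amplitude_pos: "0 < amplitude b \<sigma> \<kappa>"
proof -
  have 1: "0 < \<sigma> / q \<kappa>" using sign_\<sigma> by (auto simp: zero_less_mult_iff zero_less_divide_iff)
  have "p \<kappa> / b < 0" using sign_b by (auto simp: mult_less_0_iff divide_less_0_iff)
  then have "0 < 2 * (\<sigma> / q \<kappa>) * - (p \<kappa> / b)" using 1 by (intro mult_pos_pos) auto
  then have 2: "0 < - (2 * \<sigma> * p \<kappa> / (q \<kappa> * b))" by (simp add: field_simps)
  show "(wavenumber \<sigma> \<kappa>)\<^sup>2 = \<sigma> / q \<kappa>" "0 < wavenumber \<sigma> \<kappa>"
    "(amplitude b \<sigma> \<kappa>)\<^sup>2 = - (2 * \<sigma> * p \<kappa> / (q \<kappa> * b))" "0 < amplitude b \<sigma> \<kappa>"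
    using 1 2 by (simp_all only: wavenumber_def amplitude_def real_sqrt_pow2 less_imp_le real_sqrt_gt_0_iff)
qed

lemma coefficients_nonzero: "p \<kappa> \<noteq> 0" "q \<kappa> \<noteq> 0" "b \<noteq> 0" "\<sigma> \<noteq> 0"
  using sign_b sign_\<sigma> by auto

lemma quartic_profile_wave:
  "quartic_profile (- b / 2) \<sigma> (- 2 * \<sigma>\<^sup>2 / b * (p \<kappa> * r \<kappa> / (q \<kappa>)\<^sup>2)) (wave (b, \<sigma>, \<kappa>))"
proof -
  have "quartic_profile ((wavenumber \<sigma> \<kappa>)\<^sup>2 * p \<kappa> / (amplitude b \<sigma> \<kappa>)\<^sup>2) ((wavenumber \<sigma> \<kappa>)\<^sup>2 * q \<kappa>)
      ((wavenumber \<sigma> \<kappa>)\<^sup>2 * (amplitude b \<sigma> \<kappa>)\<^sup>2 * r \<kappa>) (wave (b, \<sigma>, \<kappa>))"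
    unfolding wave_def prod.case
    using amplitude_pos by (intro quartic_profile_rescale profile modulus) auto
  moreover have "(wavenumber \<sigma> \<kappa>)\<^sup>2 * p \<kappa> / (amplitude b \<sigma> \<kappa>)\<^sup>2 = - b / 2"
    using coefficients_nonzero by (simp add: wavenumber_sq amplitude_sq field_simps)
  moreover have "(wavenumber \<sigma> \<kappa>)\<^sup>2 * q \<kappa> = \<sigma>"
    using coefficients_nonzero by (simp add: wavenumber_sq)
  moreover have "(wavenumber \<sigma> \<kappa>)\<^sup>2 * (amplitude b \<sigma> \<kappa>)\<^sup>2 * r \<kappa>
      = - 2 * \<sigma>\<^sup>2 / b * (p \<kappa> * r \<kappa> / (q \<kappa>)\<^sup>2)"
    unfolding wavenumber_sq amplitude_sq
    using coefficients_nonzero by (simp add: field_simps power2_eq_square)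
  ultimately show ?thesis by simp
qed

lemma solves_wave:
  assumes "b = 1/c - \<beta>"
  shows "solves_profile_ode c \<beta> \<sigma> (wave (b, \<sigma>, \<kappa>))"
proof -
  have "1/2 * (\<beta> - 1/c) = - b / 2" using assms by simp
  then show ?thesis
    unfolding solves_profile_ode_iff_quartic_profile using quartic_profile_wave by auto
qed

lemma solutions_eq:
  assumes "b = 1/c - \<beta>"
  shows "solutions c \<beta> \<sigma> \<kappa> = {wave (b, \<sigma>, \<kappa>)}"
proof (intro equalityI subsetI)
  fix \<phi>
  assume "\<phi> \<in> {wave (b, \<sigma>, \<kappa>)}"
  then show "\<phi> \<in> solutions c \<beta> \<sigma> \<kappa>"
    using solves_wave[OF assms] amplitude_pos wavenumber_pos
    by (auto simp: solutions_def wave_def)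
next
  fix \<phi>
  assume "\<phi> \<in> solutions c \<beta> \<sigma> \<kappa>"
  then obtain A \<alpha> a where "0 < A" "0 < \<alpha>" and \<phi>: "\<phi> = (\<lambda>x. A * w (\<alpha> * x) \<kappa>)"
    and "quartic_profile (1/2 * (\<beta> - 1/c)) \<sigma> a \<phi>"
    by (auto simp: solutions_def solves_profile_ode_iff_quartic_profile)
  then have "1/2 * (\<beta> - 1/c) = \<alpha>\<^sup>2 * p \<kappa> / A\<^sup>2" and \<sigma>: "\<sigma> = \<alpha>\<^sup>2 * q \<kappa>"
    using rescaled_coefficients_unique[OF modulus, of A \<alpha> "1/2 * (\<beta> - 1/c)" \<sigma> a] by auto
  then have "- b / 2 = \<alpha>\<^sup>2 * p \<kappa> / A\<^sup>2" using assms by simp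
  then have "A\<^sup>2 * b = - 2 * \<alpha>\<^sup>2 * p \<kappa>" using \<open>0 < A\<close> by (simp add: field_simps)
  then have "A\<^sup>2 = - (2 * \<sigma> * p \<kappa> / (q \<kappa> * b))"
    using coefficients_nonzero by (simp add: \<sigma> field_simps)
  then have "A = amplitude b \<sigma> \<kappa>"
    using \<open>0 < A\<close> unfolding amplitude_def by (metis less_imp_le real_sqrt_unique)
  moreover have "\<alpha> = wavenumber \<sigma> \<kappa>"
    using \<open>0 < \<alpha>\<close> coefficients_nonzero by (simp add: wavenumber_def \<sigma>)
  ultimately show "\<phi> \<in> {wave (b, \<sigma>, \<kappa>)}" by (simp add: \<phi> wave_def)
qed

end

lemma inj_on_wave:
  assumes sign: "\<And>b \<sigma> \<kappa>. b \<in> B \<Longrightarrow> \<sigma> \<in> S \<Longrightarrow> \<kappa> \<in> {0<..<1} \<Longrightarrow> p \<kappa> * b < 0 \<and> 0 < q \<kappa> * \<sigma>"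
  shows "inj_on wave (B \<times> S \<times> {0<..<1})"
proof (rule inj_onI)
  fix u v
  assume "u \<in> B \<times> S \<times> {0<..<1}" "v \<in> B \<times> S \<times> {0<..<1}" and eq: "wave u = wave v"
  then obtain b \<sigma> \<kappa> b' \<sigma>' \<kappa>' where u: "u = (b, \<sigma>, \<kappa>)" and v: "v = (b', \<sigma>', \<kappa>')"
    and "b \<in> B" "\<sigma> \<in> S" and \<kappa>: "\<kappa> \<in> {0<..<1}" and "b' \<in> B" "\<sigma>' \<in> S" and \<kappa>': "\<kappa>' \<in> {0<..<1}"
    by (auto simp del: greaterThanLessThan_iff)
  then have s: "p \<kappa> * b < 0" "0 < q \<kappa> * \<sigma>" and s': "p \<kappa>' * b' < 0" "0 < q \<kappa>' * \<sigma>'"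
    using sign by blast+
  let ?R = "\<lambda>b \<sigma> \<kappa>. - 2 * \<sigma>\<^sup>2 / b * (p \<kappa> * r \<kappa> / (q \<kappa>)\<^sup>2)"
  have pos: "amplitude b \<sigma> \<kappa> \<noteq> 0" "wavenumber \<sigma> \<kappa> \<noteq> 0"
    using amplitude_pos[OF \<kappa> s] wavenumber_pos[OF \<kappa> s] by auto
  note coeff = rescaled_coefficients_unique[OF \<kappa> pos]
  have 1: "quartic_profile (- b / 2) \<sigma> (?R b \<sigma> \<kappa>)
      (\<lambda>x. amplitude b \<sigma> \<kappa> * w (wavenumber \<sigma> \<kappa> * x) \<kappa>)"
    using quartic_profile_wave[OF \<kappa> s] by (simp add: wave_def)
  have 2: "quartic_profile (- b' / 2) \<sigma>' (?R b' \<sigma>' \<kappa>')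
      (\<lambda>x. amplitude b \<sigma> \<kappa> * w (wavenumber \<sigma> \<kappa> * x) \<kappa>)"
    using quartic_profile_wave[OF \<kappa>' s'] eq unfolding u v by (simp add: wave_def)
  have "- b / 2 = - b' / 2" "\<sigma> = \<sigma>'" and R: "?R b \<sigma> \<kappa> = ?R b' \<sigma>' \<kappa>'"
    using coeff[OF 1] coeff[OF 2] by metis+
  then have "b = b'" "\<sigma> = \<sigma>'" by auto
  moreover from this R have "p \<kappa> * r \<kappa> / (q \<kappa>)\<^sup>2 = p \<kappa>' * r \<kappa>' / (q \<kappa>')\<^sup>2"
    using coefficients_nonzero[OF \<kappa> s] by (simp only: mult_cancel_left) simp
  then have "\<kappa> = \<kappa>'" using inj_onD[OF inj_invariant] \<kappa> \<kappa>' by blast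
  ultimately show "u = v" by (simp add: u v)
qed

lemma solutions_parametrized:
  assumes sign: "\<And>b \<sigma> \<kappa>. b \<in> B \<Longrightarrow> \<sigma> \<in> S \<Longrightarrow> \<kappa> \<in> {0<..<1} \<Longrightarrow> p \<kappa> * b < 0 \<and> 0 < q \<kappa> * \<sigma>"
  shows "bij_betw wave (B \<times> S \<times> {0<..<1})
    {\<phi>. \<exists>c \<beta> \<sigma> \<kappa>. 0 < \<kappa> \<and> \<kappa> < 1 \<and> c \<noteq> 0 \<and> 1/c - \<beta> \<in> B \<and> \<sigma> \<in> S \<and> \<phi> \<in> solutions c \<beta> \<sigma> \<kappa>}"
    (is "bij_betw _ _ ?T")
proof -
  have sol: "solutions c \<beta> \<sigma> \<kappa> = {wave (1/c - \<beta>, \<sigma>, \<kappa>)}"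
    if "0 < \<kappa>" "\<kappa> < 1" "1/c - \<beta> \<in> B" "\<sigma> \<in> S" for c \<beta> \<sigma> \<kappa>
    using that sign by (intro solutions_eq) auto
  have "wave ` (B \<times> S \<times> {0<..<1}) = ?T"
  proof (intro equalityI subsetI)
    fix \<phi>
    assume "\<phi> \<in> wave ` (B \<times> S \<times> {0<..<1})"
    then obtain b \<sigma> \<kappa> where "\<phi> = wave (b, \<sigma>, \<kappa>)" "b \<in> B" "\<sigma> \<in> S" "0 < \<kappa>" "\<kappa> < 1" by auto
    \<comment> \<open>Every value of \<open>1/c - \<beta>\<close> already occurs with \<open>c = 1\<close>.\<close>
    then show "\<phi> \<in> ?T"
      using sol[of \<kappa> 1 "1 - b" \<sigma>]
      by (intro CollectI exI[of _ 1] exI[of _ "1 - b"] exI[of _ \<sigma>] exI[of _ \<kappa>]) simp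
  next
    fix \<phi>
    assume "\<phi> \<in> ?T"
    then show "\<phi> \<in> wave ` (B \<times> S \<times> {0<..<1})" using sol by fastforce
  qed
  then show ?thesis using inj_on_wave[OF sign] by (simp add: bij_betw_def)
qed

end

section \<open>The dnoidal and snoidal families\<close>

lemma inj_on_div_one_plus_sq: "inj_on (\<lambda>t::real. t / (1 + t)\<^sup>2) {0<..<1}"
proof (rule inj_onI)
  fix s t :: real
  assume st: "s \<in> {0<..<1}" "t \<in> {0<..<1}" and "s / (1 + s)\<^sup>2 = t / (1 + t)\<^sup>2"
  then have "s * (1 + t)\<^sup>2 = t * (1 + s)\<^sup>2" by (simp add: frac_eq_eq)
  then have "(s - t) * (1 - s * t) = 0" by algebra
  moreover have "s * t < 1 * 1" using st by (intro mult_strict_mono) auto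
  ultimately show "s = t" by simp
qed

text \<open>
  Amplitudes \<open>0\<close>, \<open>\<pi>/4\<close> and \<open>\<pi>/2\<close> give \<open>sn\<^sup>2\<close> the values \<open>0\<close>, \<open>1/2\<close> and \<open>1\<close>.
\<close>

lemma jacobi_sn_sq_values:
  assumes "0 < \<kappa>" "\<kappa> < 1"
  obtains x y z where "(jacobi_sn x \<kappa>)\<^sup>2 = 0" "(jacobi_sn y \<kappa>)\<^sup>2 = 1/2" "(jacobi_sn z \<kappa>)\<^sup>2 = 1"
proof
  show "(jacobi_sn (ellipticF 0 \<kappa>) \<kappa>)\<^sup>2 = 0" "(jacobi_sn (ellipticF (pi/4) \<kappa>) \<kappa>)\<^sup>2 = 1/2"
    "(jacobi_sn (ellipticF (pi/2) \<kappa>) \<kappa>)\<^sup>2 = 1"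
    unfolding jacobi_sn_def jacobi_am_ellipticF[OF assms]
    by (simp_all add: sin_45 power_divide)
qed

interpretation dn: profile_family jacobi_dn "\<lambda>\<kappa>. - 1" "\<lambda>\<kappa>. 2 - \<kappa>\<^sup>2" "\<lambda>\<kappa>. - (1 - \<kappa>\<^sup>2)"
proof
  fix \<kappa> :: real
  assume "\<kappa> \<in> {0<..<1}"
  then have \<kappa>: "0 < \<kappa>" "\<kappa> < 1" by auto
  show "quartic_profile (- 1) (2 - \<kappa>\<^sup>2) (- (1 - \<kappa>\<^sup>2)) (\<lambda>u. jacobi_dn u \<kappa>)"
    by (rule quartic_profile_jacobi_dn[OF \<kappa>])
  have sq: "(jacobi_dn u \<kappa>)\<^sup>2 = 1 - \<kappa>\<^sup>2 * (jacobi_sn u \<kappa>)\<^sup>2" for u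
    using one_minus_modulus_sin_sq_pos[OF \<kappa>] by (simp add: jacobi_dn_def jacobi_sn_def less_imp_le)
  obtain x y z where sn: "(jacobi_sn x \<kappa>)\<^sup>2 = 0" "(jacobi_sn y \<kappa>)\<^sup>2 = 1/2" "(jacobi_sn z \<kappa>)\<^sup>2 = 1"
    using jacobi_sn_sq_values[OF \<kappa>] .
  have dn: "(jacobi_dn x \<kappa>)\<^sup>2 = 1" "(jacobi_dn y \<kappa>)\<^sup>2 = 1 - \<kappa>\<^sup>2 / 2" "(jacobi_dn z \<kappa>)\<^sup>2 = 1 - \<kappa>\<^sup>2"
    unfolding sq sn by simp_all
  show "\<exists>x y z. (jacobi_dn x \<kappa>)\<^sup>2 \<noteq> (jacobi_dn y \<kappa>)\<^sup>2 \<and> (jacobi_dn y \<kappa>)\<^sup>2 \<noteq> (jacobi_dn z \<kappa>)\<^sup>2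
      \<and> (jacobi_dn x \<kappa>)\<^sup>2 \<noteq> (jacobi_dn z \<kappa>)\<^sup>2"
    using \<kappa> by (intro exI[of _ x] exI[of _ y] exI[of _ z]) (simp add: dn)
next
  have "inj_on ((\<lambda>t. t / (1 + t)\<^sup>2) \<circ> (\<lambda>\<kappa>. 1 - \<kappa>\<^sup>2)) {0<..<1::real}"
  proof (rule comp_inj_on)
    show "inj_on (\<lambda>\<kappa>. 1 - \<kappa>\<^sup>2) {0<..<1::real}"
      by (auto intro!: inj_onI simp: power2_eq_iff)
    show "inj_on (\<lambda>t. t / (1 + t)\<^sup>2) ((\<lambda>\<kappa>. 1 - \<kappa>\<^sup>2) ` {0<..<1::real})"
      by (rule inj_on_subset[OF inj_on_div_one_plus_sq]) (auto simp: power_less_one_iff)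
  qed
  then show "inj_on (\<lambda>\<kappa>. - 1 * - (1 - \<kappa>\<^sup>2) / (2 - \<kappa>\<^sup>2)\<^sup>2) {0<..<1::real}"
    by (simp add: comp_def)
qed

interpretation sn: profile_family jacobi_sn "\<lambda>\<kappa>. \<kappa>\<^sup>2" "\<lambda>\<kappa>. - (1 + \<kappa>\<^sup>2)" "\<lambda>\<kappa>. 1"
proof
  fix \<kappa> :: real
  assume "\<kappa> \<in> {0<..<1}"
  then have \<kappa>: "0 < \<kappa>" "\<kappa> < 1" by auto
  show "quartic_profile (\<kappa>\<^sup>2) (- (1 + \<kappa>\<^sup>2)) 1 (\<lambda>u. jacobi_sn u \<kappa>)"
    by (rule quartic_profile_jacobi_sn[OF \<kappa>])
  obtain x y z where "(jacobi_sn x \<kappa>)\<^sup>2 = 0" "(jacobi_sn y \<kappa>)\<^sup>2 = 1/2" "(jacobi_sn z \<kappa>)\<^sup>2 = 1"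
    using jacobi_sn_sq_values[OF \<kappa>] .
  then show "\<exists>x y z. (jacobi_sn x \<kappa>)\<^sup>2 \<noteq> (jacobi_sn y \<kappa>)\<^sup>2 \<and> (jacobi_sn y \<kappa>)\<^sup>2 \<noteq> (jacobi_sn z \<kappa>)\<^sup>2
      \<and> (jacobi_sn x \<kappa>)\<^sup>2 \<noteq> (jacobi_sn z \<kappa>)\<^sup>2"
    by (intro exI[of _ x] exI[of _ y] exI[of _ z]) (simp del: power_eq_0_iff zero_eq_power2)
next
  have "inj_on ((\<lambda>t. t / (1 + t)\<^sup>2) \<circ> (\<lambda>\<kappa>. \<kappa>\<^sup>2)) {0<..<1::real}"
  proof (rule comp_inj_on)
    show "inj_on (\<lambda>\<kappa>. \<kappa>\<^sup>2) {0<..<1::real}"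
      by (auto intro!: inj_onI simp: power2_eq_iff)
    show "inj_on (\<lambda>t. t / (1 + t)\<^sup>2) ((\<lambda>\<kappa>. \<kappa>\<^sup>2) ` {0<..<1::real})"
      by (rule inj_on_subset[OF inj_on_div_one_plus_sq]) (auto simp: power_less_one_iff)
  qed
  moreover have "(- (1 + \<kappa>\<^sup>2))\<^sup>2 = (1 + \<kappa>\<^sup>2)\<^sup>2" for \<kappa> :: real by (rule power2_minus)
  ultimately show "inj_on (\<lambda>\<kappa>. \<kappa>\<^sup>2 * 1 / (- (1 + \<kappa>\<^sup>2))\<^sup>2) {0<..<1::real}"
    by (simp only: comp_def mult_1_right)
qed

lemma dn_signs:
  fixes b \<sigma> \<kappa> :: real
  assumes "b \<in> {0<..}" "\<sigma> \<in> {0<..}" "\<kappa> \<in> {0<..<1}"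
  shows "- 1 * b < 0 \<and> 0 < (2 - \<kappa>\<^sup>2) * \<sigma>"
proof -
  have "\<kappa>\<^sup>2 < 1" using assms by (simp add: power_less_one_iff)
  then show ?thesis using assms by simp
qed

lemma sn_signs:
  fixes b \<sigma> \<kappa> :: real
  assumes "b \<in> {..<0}" "\<sigma> \<in> {..<0}" "\<kappa> \<in> {0<..<1}"
  shows "\<kappa>\<^sup>2 * b < 0 \<and> 0 < - (1 + \<kappa>\<^sup>2) * \<sigma>"
proof -
  have "0 < 1 + \<kappa>\<^sup>2" by (simp add: add_pos_nonneg)
  then show ?thesis using assms by (simp add: mult_pos_neg mult_neg_neg del: mult_minus_left)
qed

lemma dnoidal_solutions_eq: "dnoidal_solutions = dn.solutions"
  by (intro ext) (simp add: dnoidal_solutions_def dn.solutions_def)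

lemma snoidal_solutions_eq: "snoidal_solutions = sn.solutions"
  by (intro ext) (simp add: snoidal_solutions_def sn.solutions_def)

theorem proposition1:
  shows
  "(\<forall>c \<beta> \<sigma> \<kappa> :: real. 0 < \<kappa> \<and> \<kappa> < 1 \<and> c \<noteq> 0 \<and> \<beta> < 1/c \<and> \<sigma> > 0 \<longrightarrow>
      (\<exists>\<phi>\<^sub>0>0. \<exists>\<alpha>>0.
         \<phi>\<^sub>0\<^sup>2 = 2 * \<sigma> / ((2 - \<kappa>\<^sup>2) * (1/c - \<beta>)) \<and>
         \<alpha>\<^sup>2 = \<sigma> / (2 - \<kappa>\<^sup>2) \<and>
         solves_profile_ode c \<beta> \<sigma> (\<lambda>x. \<phi>\<^sub>0 * jacobi_dn (\<alpha> * x) \<kappa>) \<and>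
         fundamental_period (\<lambda>x. \<phi>\<^sub>0 * jacobi_dn (\<alpha> * x) \<kappa>) (2 * ellipticK \<kappa> / \<alpha>) \<and>
         2 * ellipticK \<kappa> / \<alpha> = 2 * ellipticK \<kappa> * sqrt (2 - \<kappa>\<^sup>2) / sqrt \<sigma>))
   \<and>
   (\<exists>\<Phi> :: real \<times> real \<times> real \<Rightarrow> (real \<Rightarrow> real).
      bij_betw \<Phi> ({0<..} \<times> {0<..} \<times> {0<..<1})
        {\<phi>. \<exists>c \<beta> \<sigma> \<kappa>. 0 < \<kappa> \<and> \<kappa> < 1 \<and> c \<noteq> 0 \<and> \<beta> < 1/c \<and> \<sigma> > 0 \<and>
                \<phi> \<in> dnoidal_solutions c \<beta> \<sigma> \<kappa>} \<and>
      (\<forall>c \<beta> \<sigma> \<kappa>. 0 < \<kappa> \<and> \<kappa> < 1 \<and> c \<noteq> 0 \<and> \<beta> < 1/c \<and> \<sigma> > 0 \<longrightarrow>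
         dnoidal_solutions c \<beta> \<sigma> \<kappa> = {\<Phi> (1/c - \<beta>, \<sigma>, \<kappa>)}))
   \<and>
   (\<forall>c \<beta> \<sigma> \<kappa> :: real. 0 < \<kappa> \<and> \<kappa> < 1 \<and> c \<noteq> 0 \<and> \<beta> > 1/c \<and> \<sigma> < 0 \<longrightarrow>
      (\<exists>\<phi>\<^sub>0>0. \<exists>\<alpha>>0.
         \<phi>\<^sub>0\<^sup>2 = 2 * \<sigma> * \<kappa>\<^sup>2 / ((1/c - \<beta>) * (1 + \<kappa>\<^sup>2)) \<and>
         \<alpha>\<^sup>2 = - (\<sigma> / (1 + \<kappa>\<^sup>2)) \<and>
         solves_profile_ode c \<beta> \<sigma> (\<lambda>x. \<phi>\<^sub>0 * jacobi_sn (\<alpha> * x) \<kappa>) \<and>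
         fundamental_period (\<lambda>x. \<phi>\<^sub>0 * jacobi_sn (\<alpha> * x) \<kappa>)
           (4 * ellipticK \<kappa> * (sqrt (1 + \<kappa>\<^sup>2) / sqrt (- \<sigma>)))))
   \<and>
   (\<exists>\<Phi> :: real \<times> real \<times> real \<Rightarrow> (real \<Rightarrow> real).
      bij_betw \<Phi> ({..<0} \<times> {..<0} \<times> {0<..<1})
        {\<phi>. \<exists>c \<beta> \<sigma> \<kappa>. 0 < \<kappa> \<and> \<kappa> < 1 \<and> c \<noteq> 0 \<and> \<beta> > 1/c \<and> \<sigma> < 0 \<and>
                \<phi> \<in> snoidal_solutions c \<beta> \<sigma> \<kappa>} \<and>
      (\<forall>c \<beta> \<sigma> \<kappa>. 0 < \<kappa> \<and> \<kappa> < 1 \<and> c \<noteq> 0 \<and> \<beta> > 1/c \<and> \<sigma> < 0 \<longrightarrow>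
         snoidal_solutions c \<beta> \<sigma> \<kappa> = {\<Phi> (1/c - \<beta>, \<sigma>, \<kappa>)}))"
proof (intro conjI allI impI)
  fix c \<beta> \<sigma> \<kappa> :: real
  assume *: "0 < \<kappa> \<and> \<kappa> < 1 \<and> c \<noteq> 0 \<and> \<beta> < 1/c \<and> \<sigma> > 0"
  define b where "b = 1/c - \<beta>"
  have \<kappa>: "0 < \<kappa>" "\<kappa> < 1" and mod: "\<kappa> \<in> {0<..<1}" using * by auto
  have sign: "- 1 * b < 0" "0 < (2 - \<kappa>\<^sup>2) * \<sigma>" using dn_signs[of b \<sigma> \<kappa>] * by (auto simp: b_def)
  let ?A = "dn.amplitude b \<sigma> \<kappa>"
  let ?\<alpha> = "dn.wavenumber \<sigma> \<kappa>"
  have A: "0 < ?A" "?A\<^sup>2 = 2 * \<sigma> / ((2 - \<kappa>\<^sup>2) * (1/c - \<beta>))"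
    using dn.amplitude_pos[OF mod sign] dn.amplitude_sq[OF mod sign] by (simp_all add: b_def)
  have \<alpha>: "0 < ?\<alpha>" "?\<alpha>\<^sup>2 = \<sigma> / (2 - \<kappa>\<^sup>2)"
    using dn.wavenumber_pos[OF mod sign] dn.wavenumber_sq[OF mod sign] by simp_all
  have ode: "solves_profile_ode c \<beta> \<sigma> (\<lambda>x. ?A * jacobi_dn (?\<alpha> * x) \<kappa>)"
    using dn.solves_wave[OF mod sign b_def] by (simp add: dn.wave_def)
  have per: "fundamental_period (\<lambda>x. ?A * jacobi_dn (?\<alpha> * x) \<kappa>) (2 * ellipticK \<kappa> / ?\<alpha>)"
    using fundamental_period_rescale[OF fundamental_period_jacobi_dn[OF \<kappa>]] A(1) \<alpha>(1) by simp
  have "2 * ellipticK \<kappa> / ?\<alpha> = 2 * ellipticK \<kappa> * sqrt (2 - \<kappa>\<^sup>2) / sqrt \<sigma>"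
    by (simp add: dn.wavenumber_def real_sqrt_divide)
  then show "\<exists>\<phi>\<^sub>0>0. \<exists>\<alpha>>0.
         \<phi>\<^sub>0\<^sup>2 = 2 * \<sigma> / ((2 - \<kappa>\<^sup>2) * (1/c - \<beta>)) \<and>
         \<alpha>\<^sup>2 = \<sigma> / (2 - \<kappa>\<^sup>2) \<and>
         solves_profile_ode c \<beta> \<sigma> (\<lambda>x. \<phi>\<^sub>0 * jacobi_dn (\<alpha> * x) \<kappa>) \<and>
         fundamental_period (\<lambda>x. \<phi>\<^sub>0 * jacobi_dn (\<alpha> * x) \<kappa>) (2 * ellipticK \<kappa> / \<alpha>) \<and>
         2 * ellipticK \<kappa> / \<alpha> = 2 * ellipticK \<kappa> * sqrt (2 - \<kappa>\<^sup>2) / sqrt \<sigma>"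
    using A \<alpha> ode per by blast
next
  have "bij_betw dn.wave ({0<..} \<times> {0<..} \<times> {0<..<1})
        {\<phi>. \<exists>c \<beta> \<sigma> \<kappa>. 0 < \<kappa> \<and> \<kappa> < 1 \<and> c \<noteq> 0 \<and> \<beta> < 1/c \<and> \<sigma> > 0 \<and>
                \<phi> \<in> dnoidal_solutions c \<beta> \<sigma> \<kappa>}"
    using dn.solutions_parametrized[of "{0<..}" "{0<..}"] dn_signs by (simp add: dnoidal_solutions_eq)
  moreover have "dnoidal_solutions c \<beta> \<sigma> \<kappa> = {dn.wave (1/c - \<beta>, \<sigma>, \<kappa>)}"
    if "0 < \<kappa> \<and> \<kappa> < 1 \<and> c \<noteq> 0 \<and> \<beta> < 1/c \<and> \<sigma> > 0" for c \<beta> \<sigma> \<kappa>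
    unfolding dnoidal_solutions_eq
    using that dn_signs[of "1/c - \<beta>" \<sigma> \<kappa>] by (intro dn.solutions_eq) auto
  ultimately show "\<exists>\<Phi> :: real \<times> real \<times> real \<Rightarrow> (real \<Rightarrow> real).
      bij_betw \<Phi> ({0<..} \<times> {0<..} \<times> {0<..<1})
        {\<phi>. \<exists>c \<beta> \<sigma> \<kappa>. 0 < \<kappa> \<and> \<kappa> < 1 \<and> c \<noteq> 0 \<and> \<beta> < 1/c \<and> \<sigma> > 0 \<and>
                \<phi> \<in> dnoidal_solutions c \<beta> \<sigma> \<kappa>} \<and>
      (\<forall>c \<beta> \<sigma> \<kappa>. 0 < \<kappa> \<and> \<kappa> < 1 \<and> c \<noteq> 0 \<and> \<beta> < 1/c \<and> \<sigma> > 0 \<longrightarrow>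
         dnoidal_solutions c \<beta> \<sigma> \<kappa> = {\<Phi> (1/c - \<beta>, \<sigma>, \<kappa>)})"
    by blast
next
  fix c \<beta> \<sigma> \<kappa> :: real
  assume *: "0 < \<kappa> \<and> \<kappa> < 1 \<and> c \<noteq> 0 \<and> \<beta> > 1/c \<and> \<sigma> < 0"
  define b where "b = 1/c - \<beta>"
  have \<kappa>: "0 < \<kappa>" "\<kappa> < 1" and mod: "\<kappa> \<in> {0<..<1}" using * by auto
  have sign: "\<kappa>\<^sup>2 * b < 0" "0 < - (1 + \<kappa>\<^sup>2) * \<sigma>" using sn_signs[of b \<sigma> \<kappa>] * by (auto simp: b_def)
  let ?A = "sn.amplitude b \<sigma> \<kappa>"
  let ?\<alpha> = "sn.wavenumber \<sigma> \<kappa>"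
  have "?A\<^sup>2 = - (2 * \<sigma> * \<kappa>\<^sup>2 / (- (1 + \<kappa>\<^sup>2) * b))" by (rule sn.amplitude_sq[OF mod sign])
  also have "\<dots> = 2 * \<sigma> * \<kappa>\<^sup>2 / ((1/c - \<beta>) * (1 + \<kappa>\<^sup>2))"
    by (simp only: b_def mult_minus_left divide_minus_right minus_minus mult.commute[of "1/c - \<beta>"])
  finally have A: "0 < ?A" "?A\<^sup>2 = 2 * \<sigma> * \<kappa>\<^sup>2 / ((1/c - \<beta>) * (1 + \<kappa>\<^sup>2))"
    using sn.amplitude_pos[OF mod sign] by simp_all
  have \<alpha>: "0 < ?\<alpha>" "?\<alpha>\<^sup>2 = - (\<sigma> / (1 + \<kappa>\<^sup>2))"
    using sn.wavenumber_pos[OF mod sign] sn.wavenumber_sq[OF mod sign]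
    by (simp_all only: divide_minus_right)
  have ode: "solves_profile_ode c \<beta> \<sigma> (\<lambda>x. ?A * jacobi_sn (?\<alpha> * x) \<kappa>)"
    using sn.solves_wave[OF mod sign b_def] by (simp only: sn.wave_def prod.case)
  have "?\<alpha> = sqrt (- \<sigma>) / sqrt (1 + \<kappa>\<^sup>2)"
    by (simp only: sn.wavenumber_def real_sqrt_divide[symmetric] divide_minus_right minus_divide_left)
  then have "4 * ellipticK \<kappa> / ?\<alpha> = 4 * ellipticK \<kappa> * (sqrt (1 + \<kappa>\<^sup>2) / sqrt (- \<sigma>))"
    by simp
  then have per: "fundamental_period (\<lambda>x. ?A * jacobi_sn (?\<alpha> * x) \<kappa>)
      (4 * ellipticK \<kappa> * (sqrt (1 + \<kappa>\<^sup>2) / sqrt (- \<sigma>)))"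
    using fundamental_period_rescale[OF fundamental_period_jacobi_sn[OF \<kappa>], of ?A ?\<alpha>] A(1) \<alpha>(1)
    by simp
  show "\<exists>\<phi>\<^sub>0>0. \<exists>\<alpha>>0.
         \<phi>\<^sub>0\<^sup>2 = 2 * \<sigma> * \<kappa>\<^sup>2 / ((1/c - \<beta>) * (1 + \<kappa>\<^sup>2)) \<and>
         \<alpha>\<^sup>2 = - (\<sigma> / (1 + \<kappa>\<^sup>2)) \<and>
         solves_profile_ode c \<beta> \<sigma> (\<lambda>x. \<phi>\<^sub>0 * jacobi_sn (\<alpha> * x) \<kappa>) \<and>
         fundamental_period (\<lambda>x. \<phi>\<^sub>0 * jacobi_sn (\<alpha> * x) \<kappa>)
           (4 * ellipticK \<kappa> * (sqrt (1 + \<kappa>\<^sup>2) / sqrt (- \<sigma>)))"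
    using A \<alpha> ode per by blast
next
  have "bij_betw sn.wave ({..<0} \<times> {..<0} \<times> {0<..<1})
        {\<phi>. \<exists>c \<beta> \<sigma> \<kappa>. 0 < \<kappa> \<and> \<kappa> < 1 \<and> c \<noteq> 0 \<and> \<beta> > 1/c \<and> \<sigma> < 0 \<and>
                \<phi> \<in> snoidal_solutions c \<beta> \<sigma> \<kappa>}"
    using sn.solutions_parametrized[of "{..<0}" "{..<0}"] sn_signs by (simp add: snoidal_solutions_eq)
  moreover have "snoidal_solutions c \<beta> \<sigma> \<kappa> = {sn.wave (1/c - \<beta>, \<sigma>, \<kappa>)}"
    if "0 < \<kappa> \<and> \<kappa> < 1 \<and> c \<noteq> 0 \<and> \<beta> > 1/c \<and> \<sigma> < 0" for c \<beta> \<sigma> \<kappa>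
    unfolding snoidal_solutions_eq
    using that sn_signs[of "1/c - \<beta>" \<sigma> \<kappa>] by (intro sn.solutions_eq) auto
  ultimately show "\<exists>\<Phi> :: real \<times> real \<times> real \<Rightarrow> (real \<Rightarrow> real).
      bij_betw \<Phi> ({..<0} \<times> {..<0} \<times> {0<..<1})
        {\<phi>. \<exists>c \<beta> \<sigma> \<kappa>. 0 < \<kappa> \<and> \<kappa> < 1 \<and> c \<noteq> 0 \<and> \<beta> > 1/c \<and> \<sigma> < 0 \<and>
                \<phi> \<in> snoidal_solutions c \<beta> \<sigma> \<kappa>} \<and>
      (\<forall>c \<beta> \<sigma> \<kappa>. 0 < \<kappa> \<and> \<kappa> < 1 \<and> c \<noteq> 0 \<and> \<beta> > 1/c \<and> \<sigma> < 0 \<longrightarrow>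
         snoidal_solutions c \<beta> \<sigma> \<kappa> = {\<Phi> (1/c - \<beta>, \<sigma>, \<kappa>)})"
    by blast
qed

end
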